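(* Let $A=\operatorname{tritoep}(a,\tau\xi,\tau/\xi)\in\mathbb{R}^{n\times n}$ be a fixed nonsingular matrix with $\tau,\xi\neq0$, and let $\mathbf{w}_1\in\mathbb{S}^{n-1}$ be of full grade and such that $\mathbf{F}'_{\mathbf{w}}(\mathbf{w}_1)$ is nonsingular. Then there exist neighborhoods $U$ of $\mathbf{w}_1$ in $\mathbb{S}^{n-1}$ and $V$ of the convergence curve $\mathbf{F}(a,\tau,\xi,\mathbf{w}_1)$ in $\mathbb{R}^{n-1}$ such that $\mathbf{F}(a,\tau,\xi,\cdot):U\to V$ is invertible and bijective; i.e. every convergence curve in $V$ is attainable (by GMRES applied to $A$ with some right-hand side).
   Context: $\operatorname{tritoep}(a,b,c)$ denotes the $n\times n$ tridiagonal Toeplitz matrix with diagonal entries $a$, subdiagonal entries $b$ and superdiagonal entries $c$. $\mathbb{S}^{n-1}$ is the unit sphere in $\mathbb{R}^n$. For $\mathbf{w}_1\in\mathbb{S}^{n-1}$ the associated unit right-hand side $\mathbf{b}$ is the one for which $\mathbf{w}_1=A\mathbf{b}/\|A\mathbf{b}\|$, i.e. $\mathbf{b}=A^{-1}\mathbf{w}_1/\|A^{-1}\mathbf{w}_1\|$. $\mathbf{w}_1$ has full grade if $\mathcal{K}_n(A,\mathbf{w}_1)=\operatorname{span}\{\mathbf{w}_1,A\mathbf{w}_1,\dots,A^{n-1}\mathbf{w}_1\}$ has dimension $n$. With $K_j=[\mathbf{b},A\mathbf{b},\dots,A^{j-1}\mathbf{b}]$, the residual-curve map $\mathbf{F}(a,\tau,\xi,\mathbf{w}_1)=(F_1,\dots,F_{n-1})$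 has components $$F_k=\frac{\det(K_{k+1}^TK_{k+1})}{\det\bigl[(AK_k)^TAK_k\bigr]},\qquad k=1,\dots,n-1,$$ and $F_k=\|\mathbf{r}_k\|^2$, where $\mathbf{r}_k=\mathbf{b}-A\mathbf{x}_k$ is the $k$-th GMRES residual ($\mathbf{x}_k$ minimizing $\|\mathbf{b}-A\mathbf{x}\|$ over $\operatorname{span}\{\mathbf{b},\dots,A^{k-1}\mathbf{b}\}$). $\mathbf{F}'_{\mathbf{w}}(\mathbf{w}_1)\in\mathbb{R}^{(n-1)\times(n-1)}$ is the Jacobian of $\mathbf{F}(a,\tau,\xi,\cdot)$ on $\mathbb{S}^{n-1}$ at $\mathbf{w}_1$, with respect to the $n-1$ free parameters (local coordinates) determining $\mathbf{w}_1$. *)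

theory Defs
  imports "HOL-Analysis.Analysis" "Jordan_Normal_Form.Determinant"
begin

no_notation Matrix.vec_index (infixl \<open>$\<close> 100)
no_notation Matrix.scalar_prod (infix \<open>\<bullet>\<close> 70)
hide_const (open) Matrix.vec Matrix.mat
hide_type (open) Matrix.vec Matrix.mat
hide_const (open) Determinant.det

text \<open>
  Coordinates of \<open>real^'n\<close> are indexed by a finite linearly ordered type; \<open>pos\<close> and \<open>nth_idx\<close>
  translate between such indices and the \<^emph>\<open>0-based\<close> positions \<open>0, \<dots>, CARD('n) - 1\<close>.
\<close>

definition pos :: "'n::{finite,linorder} \<Rightarrow> nat" where
  "pos i = card {j. j < i}"

definition nth_idx :: "nat \<Rightarrow> 'n::{finite,linorder}" where
  "nth_idx k = sorted_list_of_set UNIV ! k"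

definition tritoep ::
    "real \<Rightarrow> real \<Rightarrow> real \<Rightarrow> real^'n::{finite,linorder}^'n::{finite,linorder}" where
  "tritoep a b c = (\<chi> i j.
     if pos i = pos j then a
     else if pos i = pos j + 1 then b
     else if pos j = pos i + 1 then c
     else 0)"

definition krylov_space :: "real^'n^'n \<Rightarrow> real^'n \<Rightarrow> nat \<Rightarrow> (real^'n) set" where
  "krylov_space A v k = span {((*v) A ^^ l) v | l. l < k}"

definition full_grade :: "real^'n^'n \<Rightarrow> real^'n \<Rightarrow> bool" where
  "full_grade A v \<longleftrightarrow> dim (krylov_space A v CARD('n)) = CARD('n)"

text \<open>
  The Krylov matrix \<open>K\<^sub>k\<close> has \<open>k\<close> columns with \<open>k\<close> varying, so it is a matrix with explicit
  dimensions, and \<open>A\<close> is transferred to that representation in order to form \<open>A K\<^sub>k\<close>.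
\<close>

definition matrix_to_mat :: "real^'n::{finite,linorder}^'n::{finite,linorder} \<Rightarrow> real Matrix.mat" where
  "matrix_to_mat A = Matrix.mat CARD('n) CARD('n) (\<lambda>(i, j). A $ nth_idx i $ nth_idx j)"

definition krylov_mat ::
    "real^'n::{finite,linorder}^'n::{finite,linorder} \<Rightarrow> real^'n::{finite,linorder} \<Rightarrow> nat \<Rightarrow> real Matrix.mat" where
  "krylov_mat A b k = Matrix.mat CARD('n) k (\<lambda>(i, l). (((*v) A ^^ l) b) $ nth_idx i)"

definition gram_det :: "real Matrix.mat \<Rightarrow> real" where
  "gram_det M = Determinant.det (transpose_mat M * M)"

definition unit_rhs :: "real^'n^'n \<Rightarrow> real^'n \<Rightarrow> real^'n" where
  "unit_rhs A w = (1 / norm (matrix_inv A *v w)) *\<^sub>R (matrix_inv A *v w)"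

text \<open>
  The codomain \<open>real^'m\<close> stands for the space of dimension \<open>n - 1\<close>; the component with index
  \<open>i\<close> is \<open>F\<^sub>k\<close> for \<open>k = pos i + 1\<close>.
\<close>

definition residual_curve ::
    "real \<Rightarrow> real \<Rightarrow> real \<Rightarrow> real^'n::{finite,linorder} \<Rightarrow> real^'m::{finite,linorder}" where
  "residual_curve a \<tau> \<xi> w =
     (let A = tritoep a (\<tau> * \<xi>) (\<tau> / \<xi>) :: real^'n::{finite,linorder}^'n::{finite,linorder}; b = unit_rhs A w
      in \<chi> i. let k = pos i + 1
          in gram_det (krylov_mat A b (k + 1)) / gram_det (matrix_to_mat A * krylov_mat A b k))"

text \<open>
  \<open>local_coordinates \<phi> P p w\<close>: \<open>\<phi>\<close> is a regular \<open>C\<^sup>1\<close> parametrization, with parameter domain \<open>P\<close>,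
  of a relatively open piece of the unit sphere, and \<open>p\<close> is the parameter of \<open>w\<close>.
\<close>

definition local_coordinates ::
    "(real^'m \<Rightarrow> real^'n) \<Rightarrow> (real^'m) set \<Rightarrow> real^'m \<Rightarrow> real^'n \<Rightarrow> bool" where
  "local_coordinates \<phi> P p w \<longleftrightarrow>
     open P \<and> p \<in> P \<and> \<phi> p = w \<and>
     openin (top_of_set (sphere 0 1)) (\<phi> ` P) \<and>
     (\<exists>\<psi>. homeomorphism P (\<phi> ` P) \<phi> \<psi>) \<and>
     (\<exists>\<phi>' :: real^'m \<Rightarrow> ((real^'m) \<Rightarrow>\<^sub>L (real^'n)).
        continuous_on P \<phi>' \<and>
        (\<forall>u\<in>P. (\<phi> has_derivative blinfun_apply (\<phi>' u)) (at u) \<and> inj (blinfun_apply (\<phi>' u))))"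

definition curve_jacobian ::
    "real \<Rightarrow> real \<Rightarrow> real \<Rightarrow> (real^'m::{finite,linorder} \<Rightarrow> real^'n::{finite,linorder}) \<Rightarrow> real^'m::{finite,linorder} \<Rightarrow>
     real^'m::{finite,linorder}^'m::{finite,linorder}" where
  "curve_jacobian a \<tau> \<xi> \<phi> p = jacobian (\<lambda>u. residual_curve a \<tau> \<xi> (\<phi> u)) (at p)"

definition gmres_iterate :: "real^'n^'n \<Rightarrow> real^'n \<Rightarrow> nat \<Rightarrow> real^'n \<Rightarrow> bool" where
  "gmres_iterate A b k x \<longleftrightarrow>
     is_arg_min (\<lambda>y. norm (b - A *v y)) (\<lambda>y. y \<in> krylov_space A b k) x"

text \<open>
  Curves consist of squared residual norms for steps \<open>1, \<dots>, n - 1\<close>, and right-hand sides are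
  normalized, so that the (omitted) initial residual norm is \<open>1\<close>.
\<close>

definition attainable :: "real^'n^'n \<Rightarrow> real^'m::{finite,linorder} \<Rightarrow> bool" where
  "attainable A f \<longleftrightarrow>
     (\<exists>b. norm b = 1 \<and>
        (\<forall>i. \<exists>x. gmres_iterate A b (pos i + 1) x \<and> f $ i = (norm (b - A *v x))\<^sup>2))"

end

theory Submission
  imports Defs
begin

text \<open>
  All Gram determinants in \<open>F\<close> are polynomials in inner products of Krylov vectors of the right-hand
  side, hence \<open>F\<close> is \<open>C\<^sup>1\<close> in the local coordinates wherever its denominators do not vanish. The
  denominators involve \<open>A\<^sup>l\<^sup>+\<^sup>1 b\<close>, a multiple of \<open>A\<^sup>l w\<close>, so full grade makes them nonzero at \<open>w\<^sub>1\<close>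
  and therefore in a neighbourhood of it. There the inverse function theorem applies. Moreover the
  quotient of Gram determinants is the squared distance from \<open>b\<close> to the span of
  \<open>A b, \<dots>, A\<^sup>k b\<close>, which is what GMRES minimizes; hence every curve in the image is attained by
  the right-hand side belonging to its preimage.
\<close>

section \<open>Continuously differentiable maps\<close>

text \<open>The derivative is the full one at each point, and continuity is in the space of bounded
  linear maps. This is the form that \<open>local_coordinates\<close> supplies and that the inverse
  function theorem consumes.\<close>

definition C1_on :: "('a::real_normed_vector \<Rightarrow> 'b::real_normed_vector) \<Rightarrow> 'a set \<Rightarrow> bool" where
  "C1_on f S \<longleftrightarrow> (\<exists>f' :: 'a \<Rightarrow> ('a \<Rightarrow>\<^sub>L 'b).
     continuous_on S f' \<and> (\<forall>x\<in>S. (f has_derivative blinfun_apply (f' x)) (at x)))"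

lemma C1_onI:
  fixes f' :: "'a::real_normed_vector \<Rightarrow> ('a \<Rightarrow>\<^sub>L 'b::real_normed_vector)"
  assumes "continuous_on S f'" "\<And>x. x \<in> S \<Longrightarrow> (f has_derivative blinfun_apply (f' x)) (at x)"
  shows "C1_on f S"
  using assms unfolding C1_on_def by blast

lemma C1_on_imp_continuous_on: "C1_on f S \<Longrightarrow> continuous_on S f"
  unfolding C1_on_def by (meson continuous_at_imp_continuous_on has_derivative_continuous)

lemma C1_on_subset: "C1_on f S \<Longrightarrow> T \<subseteq> S \<Longrightarrow> C1_on f T"
  unfolding C1_on_def by (meson continuous_on_subset subsetD)

lemma C1_on_const: "C1_on (\<lambda>_. c) S"
  by (rule C1_onI[where f' = "\<lambda>_. 0"]) (auto simp: zero_blinfun.rep_eq)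

lemma C1_on_add:
  assumes "C1_on f S" "C1_on g S"
  shows "C1_on (\<lambda>x. f x + g x) S"
proof -
  obtain f' where f': "continuous_on S f'"
      "\<And>x. x \<in> S \<Longrightarrow> (f has_derivative blinfun_apply (f' x)) (at x)"
    using assms(1) unfolding C1_on_def by blast
  obtain g' where g': "continuous_on S g'"
      "\<And>x. x \<in> S \<Longrightarrow> (g has_derivative blinfun_apply (g' x)) (at x)"
    using assms(2) unfolding C1_on_def by blast
  show ?thesis
    by (rule C1_onI[where f' = "\<lambda>x. f' x + g' x"])
       (auto intro!: continuous_intros derivative_eq_intros f' g' simp: blinfun.bilinear_simps)
qed

lemma C1_on_sum: "(\<And>i. i \<in> I \<Longrightarrow> C1_on (f i) S) \<Longrightarrow> C1_on (\<lambda>x. \<Sum>i\<in>I. f i x) S"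
  by (induction I rule: infinite_finite_induct) (auto intro: C1_on_const C1_on_add)

lemma C1_on_bounded_linear:
  assumes "bounded_linear L" "C1_on f S"
  shows "C1_on (\<lambda>x. L (f x)) S"
proof -
  obtain f' where f': "continuous_on S f'"
      "\<And>x. x \<in> S \<Longrightarrow> (f has_derivative blinfun_apply (f' x)) (at x)"
    using assms(2) unfolding C1_on_def by blast
  show ?thesis
    by (rule C1_onI[where f' = "\<lambda>x. Blinfun L o\<^sub>L f' x"])
       (auto intro!: continuous_intros f' bounded_linear.has_derivative[OF assms(1)]
          simp: blinfun_compose.rep_eq o_def bounded_linear_Blinfun_apply[OF assms(1)])
qed

lemma C1_on_inner:
  fixes f g :: "'a::real_normed_vector \<Rightarrow> 'b::real_inner"
  assumes "C1_on f S" "C1_on g S"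
  shows "C1_on (\<lambda>x. f x \<bullet> g x) S"
proof -
  obtain f' where f': "continuous_on S f'"
      "\<And>x. x \<in> S \<Longrightarrow> (f has_derivative blinfun_apply (f' x)) (at x)"
    using assms(1) unfolding C1_on_def by blast
  obtain g' where g': "continuous_on S g'"
      "\<And>x. x \<in> S \<Longrightarrow> (g has_derivative blinfun_apply (g' x)) (at x)"
    using assms(2) unfolding C1_on_def by blast
  show ?thesis
    by (rule C1_onI[where
          f' = "\<lambda>x. (blinfun_inner_right (f x) o\<^sub>L g' x) + (blinfun_inner_left (g x) o\<^sub>L f' x)"])
       (auto intro!: continuous_intros derivative_eq_intros f' g'
          bounded_linear.continuous_on[OF bounded_linear_blinfun_inner_right]
          bounded_linear.continuous_on[OF bounded_linear_blinfun_inner_left]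
          assms[THEN C1_on_imp_continuous_on] simp: blinfun.bilinear_simps)
qed

lemma C1_on_mult:
  fixes f g :: "'a::real_normed_vector \<Rightarrow> real"
  shows "C1_on f S \<Longrightarrow> C1_on g S \<Longrightarrow> C1_on (\<lambda>x. f x * g x) S"
  using C1_on_inner[of f S g] by simp

lemma C1_on_prod:
  fixes f :: "'i \<Rightarrow> 'a::real_normed_vector \<Rightarrow> real"
  shows "(\<And>i. i \<in> I \<Longrightarrow> C1_on (f i) S) \<Longrightarrow> C1_on (\<lambda>x. \<Prod>i\<in>I. f i x) S"
  by (induction I rule: infinite_finite_induct) (auto intro: C1_on_const C1_on_mult)

lemma C1_on_scaleR:
  fixes f :: "'a::real_normed_vector \<Rightarrow> real" and g :: "'a \<Rightarrow> 'b::real_normed_vector"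
  assumes "C1_on f S" "C1_on g S"
  shows "C1_on (\<lambda>x. f x *\<^sub>R g x) S"
proof -
  obtain f' where f': "continuous_on S f'"
      "\<And>x. x \<in> S \<Longrightarrow> (f has_derivative blinfun_apply (f' x)) (at x)"
    using assms(1) unfolding C1_on_def by blast
  obtain g' where g': "continuous_on S g'"
      "\<And>x. x \<in> S \<Longrightarrow> (g has_derivative blinfun_apply (g' x)) (at x)"
    using assms(2) unfolding C1_on_def by blast
  show ?thesis
    by (rule C1_onI[where
          f' = "\<lambda>x. (blinfun_scaleR_right (f x) o\<^sub>L g' x) + (blinfun_scaleR_left (g x) o\<^sub>L f' x)"])
       (auto intro!: continuous_intros derivative_eq_intros f' g'
          bounded_linear.continuous_on[OF bounded_linear_blinfun_scaleR_right]
          bounded_linear.continuous_on[OF bounded_linear_blinfun_scaleR_left]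
          assms[THEN C1_on_imp_continuous_on] simp: blinfun.bilinear_simps)
qed

text \<open>The chain rule for a scalar outer function, serving reciprocals and square roots: the
  only non-polynomial operations in the residual curve.\<close>

lemma C1_on_compose_real:
  fixes f :: "'a::real_normed_vector \<Rightarrow> real" and h h' :: "real \<Rightarrow> real"
  assumes "C1_on f S" "\<And>x. x \<in> S \<Longrightarrow> (h has_real_derivative h' (f x)) (at (f x))"
    "continuous_on (f ` S) h'"
  shows "C1_on (\<lambda>x. h (f x)) S"
proof -
  obtain f' where f': "continuous_on S f'"
      "\<And>x. x \<in> S \<Longrightarrow> (f has_derivative blinfun_apply (f' x)) (at x)"
    using assms(1) unfolding C1_on_def by blast
  show ?thesis
  proof (rule C1_onI[where f' = "\<lambda>x. h' (f x) *\<^sub>R f' x"])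
    show "continuous_on S (\<lambda>x. h' (f x) *\<^sub>R f' x)"
      by (intro continuous_intros f' continuous_on_compose2[OF assms(3)]
          C1_on_imp_continuous_on assms(1)) auto
    show "((\<lambda>x. h (f x)) has_derivative blinfun_apply (h' (f x) *\<^sub>R f' x)) (at x)"
      if "x \<in> S" for x
      using DERIV_compose_FDERIV[OF assms(2)[OF that] f'(2)[OF that]]
      by (simp add: scaleR_blinfun.rep_eq mult.commute)
  qed
qed

lemma C1_on_inverse:
  fixes f :: "'a::real_normed_vector \<Rightarrow> real"
  assumes "C1_on f S" "\<And>x. x \<in> S \<Longrightarrow> f x \<noteq> 0"
  shows "C1_on (\<lambda>x. inverse (f x)) S"
  by (rule C1_on_compose_real[OF assms(1), where h' = "\<lambda>y. - inverse (y ^ 2)"])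
     (use assms(2) in \<open>auto intro!: derivative_eq_intros continuous_intros simp: power2_eq_square\<close>)

lemma C1_on_divide:
  fixes f g :: "'a::real_normed_vector \<Rightarrow> real"
  assumes "C1_on f S" "C1_on g S" "\<And>x. x \<in> S \<Longrightarrow> g x \<noteq> 0"
  shows "C1_on (\<lambda>x. f x / g x) S"
  unfolding divide_inverse using assms by (intro C1_on_mult C1_on_inverse)

lemma C1_on_norm:
  fixes f :: "'a::real_normed_vector \<Rightarrow> 'b::real_inner"
  assumes "C1_on f S" "\<And>x. x \<in> S \<Longrightarrow> f x \<noteq> 0"
  shows "C1_on (\<lambda>x. norm (f x)) S"
  unfolding norm_eq_sqrt_inner
  by (rule C1_on_compose_real[OF C1_on_inner[OF assms(1) assms(1)],
        where h' = "\<lambda>y. inverse (2 * sqrt y)"])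
     (use assms(2) in \<open>auto simp: inverse_eq_divide leD[OF inner_ge_zero] intro!: derivative_eq_intros continuous_intros\<close>)

lemma C1_on_vec_lambda:
  fixes f :: "'a::real_normed_vector \<Rightarrow> 'i::finite \<Rightarrow> real"
  assumes "\<And>i. C1_on (\<lambda>x. f x i) S"
  shows "C1_on (\<lambda>x. \<chi> i. f x i) S"
proof -
  have "(\<lambda>x. \<chi> i. f x i) = (\<lambda>x. \<Sum>i\<in>UNIV. f x i *\<^sub>R axis i 1)"
    by (simp add: fun_eq_iff Finite_Cartesian_Product.vec_eq_iff sum_component axis_def if_distrib cong: if_cong)
  then show ?thesis
    using assms by (simp add: C1_on_sum C1_on_scaleR C1_on_const)
qed

lemma permutes_atLeast0LessThan_less: "p permutes {0..<k} \<Longrightarrow> i < k \<Longrightarrow> p i < (k::nat)"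
  using permutes_in_image[of p "{0..<k}" i] by simp

text \<open>The Leibniz formula writes the determinant as a finite sum of signed products of
  entries, so sums and products suffice.\<close>

lemma C1_on_det:
  fixes f :: "'a::real_normed_vector \<Rightarrow> nat \<Rightarrow> nat \<Rightarrow> real"
  assumes "\<And>i j. i < k \<Longrightarrow> j < k \<Longrightarrow> C1_on (\<lambda>x. f x i j) S"
  shows "C1_on (\<lambda>x. Determinant.det (Matrix.mat k k (\<lambda>(i, j). f x i j))) S"
proof -
  have "Determinant.det (Matrix.mat k k (\<lambda>(i, j). f x i j)) =
    (\<Sum>p | p permutes {0..<k}. signof p * (\<Prod>i = 0..<k. f x i (p i)))" for x
    by (subst det_def'[of _ k]) (auto intro!: sum.cong prod.cong simp: permutes_atLeast0LessThan_less)
  then show ?thesis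
    using assms by (auto intro!: C1_on_sum C1_on_mult C1_on_const C1_on_prod simp: permutes_atLeast0LessThan_less)
qed

section \<open>Gram determinants\<close>

text \<open>A sequence with a length stands for the columns of a matrix; dropping the first column
  is then an index shift. The empty case \<open>k = 0\<close> has value 1.\<close>

definition gram :: "(nat \<Rightarrow> 'a::real_inner) \<Rightarrow> nat \<Rightarrow> real" where
  "gram v k = Determinant.det (Matrix.mat k k (\<lambda>(i, j). v i \<bullet> v j))"

lemma C1_on_gram:
  fixes v :: "'a::real_normed_vector \<Rightarrow> nat \<Rightarrow> 'b::real_inner"
  shows "(\<And>l. C1_on (\<lambda>x. v x l) S) \<Longrightarrow> C1_on (\<lambda>x. gram (v x) k) S"
  unfolding gram_def by (intro C1_on_det C1_on_inner)

text \<open>Coefficients are indexed by positions rather than by vectors, so repetitions in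
  \<open>v\<close> cause no trouble.\<close>

lemma span_image_lessThanE:
  fixes v :: "nat \<Rightarrow> 'a::real_vector"
  assumes "x \<in> span (v ` {..<k})"
  obtains c where "x = (\<Sum>l<k. c l *\<^sub>R v l)"
proof -
  have "\<exists>c. x = (\<Sum>l<k. c l *\<^sub>R v l)"
    using assms
  proof (induction k arbitrary: x)
    case (Suc k)
    then obtain t where "x - t *\<^sub>R v k \<in> span (v ` {..<k})"
      by (auto simp: lessThan_Suc span_insert)
    then obtain c where "x - t *\<^sub>R v k = (\<Sum>l<k. c l *\<^sub>R v l)"
      using Suc.IH by blast
    then have "x = (\<Sum>l<Suc k. (c(k := t)) l *\<^sub>R v l)"
      by (simp add: algebra_simps)
    then show ?case by blast
  qed simp
  then show thesis using that by blast
qed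

text \<open>A kernel vector of the Gram matrix gives a combination \<open>?s\<close> orthogonal to
  every \<open>v i\<close>, hence to itself; so \<open>?s\<close> vanishes and independence kills
  the coefficients.\<close>

lemma gram_nonzero:
  fixes v :: "nat \<Rightarrow> 'a::real_inner"
  assumes "\<And>c l. (\<Sum>l<k. c l *\<^sub>R v l) = 0 \<Longrightarrow> l < k \<Longrightarrow> c l = 0"
  shows "gram v k \<noteq> 0"
proof
  let ?G = "Matrix.mat k k (\<lambda>(i, j). v i \<bullet> v j)"
  assume "gram v k = 0"
  then obtain y where y: "y \<in> carrier_vec k" "y \<noteq> 0\<^sub>v k" "?G *\<^sub>v y = 0\<^sub>v k"
    unfolding gram_def by (subst (asm) det_0_iff_vec_prod_zero[of _ k]) auto
  let ?c = "\<lambda>l. vec_index y l" and ?s = "\<Sum>l<k. vec_index y l *\<^sub>R v l"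
  have "v i \<bullet> ?s = 0" if "i < k" for i
  proof -
    have "vec_index (?G *\<^sub>v y) i = 0"
      using y that by simp
    then show ?thesis
      using y(1) that
      by (auto simp: scalar_prod_def inner_sum_right lessThan_atLeast0 mult.commute)
  qed
  then have "?s \<bullet> ?s = 0"
    by (subst inner_sum_left) simp
  then have "?s = 0" by simp
  then have "?c l = 0" if "l < k" for l
    using assms[of ?c] that by blast
  then have "y = 0\<^sub>v k"
    using y(1) by auto
  with y(2) show False ..
qed

text \<open>
  Replacing \<open>u 0\<close> by its component \<open>r\<close> orthogonal to the other vectors in one argument of the
  inner product is a unimodular column operation, and it clears the first column below \<open>r \<bullet> r\<close>.
\<close>

lemma gram_Suc:
  fixes u :: "nat \<Rightarrow> 'a::real_inner"
  assumes "u 0 - r \<in> span ((\<lambda>l. u (Suc l)) ` {..<k})"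
    and orth: "\<And>l. l < k \<Longrightarrow> r \<bullet> u (Suc l) = 0"
  shows "gram u (Suc k) = (r \<bullet> r) * gram (\<lambda>l. u (Suc l)) k"
proof -
  obtain c where c: "u 0 - r = (\<Sum>l<k. c l *\<^sub>R u (Suc l))"
    using assms(1) by (rule span_image_lessThanE)
  let ?t = "case_nat r (\<lambda>l. u (Suc l))"
  let ?G = "Matrix.mat (Suc k) (Suc k) (\<lambda>(i, j). u i \<bullet> u j)"
  let ?H = "Matrix.mat (Suc k) (Suc k) (\<lambda>(i, j). u i \<bullet> ?t j)"
  \<comment> \<open>Column 0 lists the coefficients of \<open>u 0\<close> in terms of
    \<open>r, u 1, ..., u k\<close>. Row \<open>i > 0\<close> belongs to \<open>u i\<close>, whose
    coefficient is \<open>c (i - 1)\<close>.\<close>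
  let ?L = "Matrix.mat (Suc k) (Suc k)
    (\<lambda>(i, j). if i = j then 1 else if j = 0 then c (i - 1) else 0)"
  have ut: "u j = (\<Sum>l<Suc k. (?L $$ (l, j)) *\<^sub>R ?t l)" if "j < Suc k" for j
  proof (cases j)
    case 0
    have "u 0 = r + (\<Sum>l<k. c l *\<^sub>R u (Suc l))"
      using c by (simp add: algebra_simps)
    then show ?thesis
      using 0 by (simp add: sum.lessThan_Suc_shift del: sum.lessThan_Suc)
  next
    case (Suc j')
    then show ?thesis
      using that
      by (simp add: sum.lessThan_Suc_shift if_distrib[of "\<lambda>x. x *\<^sub>R _"]
          del: sum.lessThan_Suc cong: if_cong)
  qed
  have "?G = ?H * ?L"
  proof (rule eq_matI)
    fix i j assume "i < dim_row (?H * ?L)" "j < dim_col (?H * ?L)"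
    then have ij: "i < Suc k" "j < Suc k" by simp_all
    have "u i \<bullet> u j = (\<Sum>l<Suc k. (?L $$ (l, j)) * (u i \<bullet> ?t l))"
      by (subst ut[OF ij(2)]) (simp only: inner_sum_right inner_scaleR_right)
    also have "\<dots> = (?H * ?L) $$ (i, j)"
      using ij unfolding times_mat_def scalar_prod_def
      by (auto simp: lessThan_atLeast0 mult.commute intro!: sum.cong)
    finally show "?G $$ (i, j) = (?H * ?L) $$ (i, j)"
      using ij by simp
  qed auto
  then have "Determinant.det ?G = Determinant.det ?H * Determinant.det ?L"
    by (simp add: det_mult[of _ "Suc k"])
  moreover have "Determinant.det ?L = 1"
    by (subst det_lower_triangular[of "Suc k"]) (auto simp: prod_list_diag_prod)
  moreover have "Determinant.det ?H = (r \<bullet> r) * gram (\<lambda>l. u (Suc l)) k"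
  proof -
    \<comment> \<open>Since \<open>u 0 - r\<close> is orthogonal to \<open>r\<close>, the corner
      entry \<open>u 0 \<bullet> r\<close> of \<open>?H\<close> equals \<open>r \<bullet> r\<close>.
      Expanding along column 0 leaves only this entry.\<close>
    have "(\<Sum>l<k. c l *\<^sub>R u (Suc l)) \<bullet> r = 0"
      using orth by (simp add: inner_sum_right inner_commute[of _ r])
    then have "u 0 \<bullet> r = r \<bullet> r"
      using c by (metis diff_eq_eq inner_add_left add_0)
    moreover have "mat_delete ?H 0 0 = Matrix.mat k k (\<lambda>(i, j). u (Suc i) \<bullet> u (Suc j))"
      by (rule eq_matI) (auto simp: mat_delete_def)
    ultimately show ?thesis
      using orth
      by (subst laplace_expansion_column[of _ "Suc k" 0])
         (auto simp: sum.lessThan_Suc_shift cofactor_def gram_def inner_commute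
               simp del: sum.lessThan_Suc)
  qed
  ultimately show ?thesis
    by (simp add: gram_def)
qed

lemma matrix_inv_right:
  fixes A :: "real^'n^'n"
  assumes "invertible A"
  shows "A ** matrix_inv A = mat 1"
  using assms unfolding invertible_def matrix_inv_def by (rule someI2_ex) blast

section \<open>Krylov matrices in terms of Gram determinants\<close>

lemma pos_less_card: "pos (i :: 'm::{finite,linorder}) < CARD('m)"
  unfolding pos_def by (rule psubset_card_mono) auto

lemma bij_betw_nth_idx:
  "bij_betw (nth_idx :: nat \<Rightarrow> 'n::{finite,linorder}) {0..<CARD('n)} UNIV"
  unfolding nth_idx_def by (rule bij_betw_nth) auto

lemma sum_nth_idx:
  fixes f :: "'n::{finite,linorder} \<Rightarrow> 'a::comm_monoid_add"
  shows "(\<Sum>i = 0..<CARD('n). f (nth_idx i)) = (\<Sum>i\<in>UNIV. f i)"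
  by (rule sum.reindex_bij_betw[OF bij_betw_nth_idx])

lemma gram_det_columns:
  fixes v :: "nat \<Rightarrow> real^'n::{finite,linorder}"
  shows "gram_det (Matrix.mat CARD('n) k (\<lambda>(i, l). v l $ nth_idx i)) = gram v k"
    (is "gram_det ?M = _")
proof -
  have "transpose_mat ?M * ?M = Matrix.mat k k (\<lambda>(i, j). v i \<bullet> v j)"
    by (rule eq_matI) (auto simp: scalar_prod_def inner_vec_def sum_nth_idx[symmetric])
  then show ?thesis
    unfolding gram_det_def gram_def by simp
qed

lemma gram_det_krylov_mat: "gram_det (krylov_mat A b k) = gram (\<lambda>l. ((*v) A ^^ l) b) k"
  unfolding krylov_mat_def by (rule gram_det_columns)

lemma gram_det_mult_krylov_mat:
  "gram_det (matrix_to_mat A * krylov_mat A b k) = gram (\<lambda>l. ((*v) A ^^ Suc l) b) k"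
proof -
  have "matrix_to_mat A * krylov_mat A b k =
      Matrix.mat CARD('a) k (\<lambda>(i, l). ((*v) A ^^ Suc l) b $ nth_idx i)"
    by (rule eq_matI)
       (auto simp: matrix_to_mat_def krylov_mat_def scalar_prod_def
          matrix_vector_mult_def sum_nth_idx[symmetric])
  then show ?thesis
    by (simp only: gram_det_columns)
qed

text \<open>Numerator and denominator take the shape of \<open>gram_Suc\<close> with
  \<open>u l\<close> the \<open>l\<close>-th Krylov vector: the denominator drops the vector
  \<open>b\<close> itself.\<close>

lemma residual_curve_nth:
  fixes w :: "real^'n::{finite,linorder}" and i :: "'m::{finite,linorder}"
  assumes "A = tritoep a (\<tau> * \<xi>) (\<tau> / \<xi>)"
  shows "residual_curve a \<tau> \<xi> w $ i =
    gram (\<lambda>l. ((*v) A ^^ l) (unit_rhs A w)) (Suc (pos i + 1)) /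
    gram (\<lambda>l. ((*v) A ^^ Suc l) (unit_rhs A w)) (pos i + 1)"
  unfolding residual_curve_def assms by (simp add: Let_def gram_det_krylov_mat gram_det_mult_krylov_mat
      del: funpow.simps)

section \<open>GMRES residuals\<close>

lemma krylov_space_eq: "krylov_space A v k = span ((\<lambda>l. ((*v) A ^^ l) v) ` {..<k})"
  unfolding krylov_space_def by (rule arg_cong[of _ _ span]) auto

text \<open>By \<open>gram_Suc\<close> the quotient is \<open>r \<bullet> r\<close>, where
  \<open>r\<close> is the component of \<open>b\<close> orthogonal to the image of the Krylov space
  under \<open>A\<close>. That component is the GMRES residual.\<close>

lemma gmres_residual:
  fixes A :: "real^'n^'n"
  assumes nz: "gram (\<lambda>l. ((*v) A ^^ Suc l) b) k \<noteq> 0"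
  shows "\<exists>x. gmres_iterate A b k x \<and>
    gram (\<lambda>l. ((*v) A ^^ l) b) (Suc k) / gram (\<lambda>l. ((*v) A ^^ Suc l) b) k = (norm (b - A *v x))\<^sup>2"
proof -
  let ?T = "(\<lambda>l. ((*v) A ^^ Suc l) b) ` {..<k}"
  have img: "(*v) A ` krylov_space A b k = span ?T"
    by (simp add: krylov_space_eq linear_span_image[symmetric] image_image)
  obtain y r where y: "y \<in> span ?T" and r: "\<And>w. w \<in> span ?T \<Longrightarrow> Linear_Algebra.orthogonal r w"
      and b: "b = y + r"
    using orthogonal_subspace_decomp_exists[of ?T b] by blast
  obtain x where x: "x \<in> krylov_space A b k" "y = A *v x"
    using y img by blast
  have "norm r \<le> norm (b - A *v z)" if "z \<in> krylov_space A b k" for z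
  proof -
    \<comment> \<open>Passing from the candidate \<open>x\<close> to \<open>z\<close> changes the
      residual \<open>r\<close> by a vector orthogonal to it, which cannot shorten it.\<close>
    have "y - A *v z \<in> span ?T"
      using y img that by (intro span_diff) auto
    then have "(norm (r + (y - A *v z)))\<^sup>2 = (norm r)\<^sup>2 + (norm (y - A *v z))\<^sup>2"
      by (intro norm_add_Pythagorean r)
    moreover have "b - A *v z = r + (y - A *v z)"
      using b by simp
    ultimately show ?thesis
      by (metis le_add_same_cancel1 norm_ge_zero power2_le_imp_le zero_le_power2)
  qed
  moreover have "b - A *v x = r"
    using b x by simp
  ultimately have "gmres_iterate A b k x"
    using x unfolding gmres_iterate_def is_arg_min_def by force
  moreover have "gram (\<lambda>l. ((*v) A ^^ l) b) (Suc k) =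
      (r \<bullet> r) * gram (\<lambda>l. ((*v) A ^^ Suc l) b) k"
  proof (rule gram_Suc)
    show "((*v) A ^^ 0) b - r \<in> span ?T"
      using b y by simp
    show "r \<bullet> ((*v) A ^^ Suc l) b = 0" if "l < k" for l
      using r[OF span_base] that unfolding Linear_Algebra.orthogonal_def by blast
  qed
  ultimately show ?thesis
    using nz \<open>b - A *v x = r\<close> by (auto simp: power2_norm_eq_inner)
qed

section \<open>Full grade and nonvanishing denominators\<close>

text \<open>A family of \<open>n\<close> vectors spanning dimension \<open>n\<close> must be
  pairwise distinct and independent. Distinctness matters here because the coefficients are indexed
  by powers of \<open>A\<close>.\<close>

lemma full_grade_independent:
  fixes A :: "real^'n^'n"
  assumes "full_grade A w" "k \<le> CARD('n)" and sum0: "(\<Sum>l<k. c l *\<^sub>R ((*v) A ^^ l) w) = 0"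
    and "l < k"
  shows "c l = 0"
proof -
  let ?f = "\<lambda>l. ((*v) A ^^ l) w" and ?N = "{..<CARD('n)}"
  have "dim (?f ` ?N) = CARD('n)"
    using assms(1) unfolding full_grade_def krylov_space_eq by simp
  moreover have "dim (?f ` ?N) \<le> card (?f ` ?N)"
    by (rule dim_le_card') simp
  moreover have "card (?f ` ?N) \<le> CARD('n)"
    using card_image_le[of ?N ?f] by simp
  ultimately have card: "card (?f ` ?N) = card ?N" "dim (?f ` ?N) = card (?f ` ?N)"
    by simp_all
  have "inj_on ?f ?N"
    using card(1) by (intro eq_card_imp_inj_on) simp_all
  then have inj: "inj_on ?f {..<k}"
    using assms(2) by (auto intro: inj_on_subset)
  have "independent (?f ` ?N)"
    using card by (intro card_le_dim_spanning[of _ "?f ` ?N"]) (auto intro: span_base)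
  then have ind: "independent (?f ` {..<k})"
    by (rule independent_mono) (use assms(2) in auto)
  \<comment> \<open>Recovers the power from the vector, turning the indexed sum into one over the
    independent set.\<close>
  let ?g = "the_inv_into {..<k} ?f"
  have "(\<Sum>v\<in>?f ` {..<k}. c (?g v) *\<^sub>R v) = (\<Sum>l<k. c l *\<^sub>R ?f l)"
    by (subst sum.reindex[OF inj]) (auto simp: the_inv_into_f_f[OF inj] intro!: sum.cong)
  then have "c (?g (?f l)) = 0"
    using sum0 \<open>l < k\<close> by (intro independentD[OF ind, of "?f ` {..<k}"]) auto
  then show ?thesis
    using the_inv_into_f_f[OF inj] \<open>l < k\<close> by simp
qed

lemma matrix_inv_mult_nonzero:
  fixes A :: "real^'n^'n"
  assumes "invertible A" "w \<noteq> 0"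
  shows "matrix_inv A *v w \<noteq> 0"
  by (metis assms matrix_inv_right matrix_vector_mul_assoc matrix_vector_mul_lid
      matrix_vector_mult_0_right)

lemma norm_unit_rhs:
  fixes A :: "real^'n^'n"
  assumes "invertible A" "w \<noteq> 0"
  shows "norm (unit_rhs A w) = 1"
  using matrix_inv_mult_nonzero[OF assms] by (simp add: unit_rhs_def)

text \<open>One factor \<open>A\<close> cancels the inverse in the right-hand side. This is how a
  condition on the Krylov vectors of \<open>w\<close> controls the denominators, which are built
  from those of \<open>b\<close>.\<close>

lemma krylov_Suc_unit_rhs:
  fixes A :: "real^'n^'n"
  assumes "invertible A"
  shows "((*v) A ^^ Suc l) (unit_rhs A w) =
    (1 / norm (matrix_inv A *v w)) *\<^sub>R ((*v) A ^^ l) w"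
proof (induction l)
  case 0
  then show ?case
    by (simp add: unit_rhs_def matrix_vector_mult_scaleR matrix_vector_mul_assoc
        matrix_inv_right[OF assms])
next
  case (Suc l)
  then show ?case
    by (simp add: matrix_vector_mult_scaleR)
qed

lemma gram_krylov_nonzero:
  fixes A :: "real^'n^'n"
  assumes "invertible A" "full_grade A w" "w \<noteq> 0" "k \<le> CARD('n)"
  shows "gram (\<lambda>l. ((*v) A ^^ Suc l) (unit_rhs A w)) k \<noteq> 0"
proof (rule gram_nonzero)
  fix c l
  let ?s = "1 / norm (matrix_inv A *v w)"
  assume "(\<Sum>l<k. c l *\<^sub>R ((*v) A ^^ Suc l) (unit_rhs A w)) = 0" "l < k"
  then have "(\<Sum>l<k. (c l * ?s) *\<^sub>R ((*v) A ^^ l) w) = 0"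
    unfolding krylov_Suc_unit_rhs[OF assms(1)] by simp
  from full_grade_independent[OF assms(2,4) this \<open>l < k\<close>] show "c l = 0"
    using matrix_inv_mult_nonzero[OF assms(1,3)] by simp
qed

text \<open>The single right-hand side \<open>unit_rhs A w\<close> serves all steps
  \<open>k\<close>, each by \<open>gmres_residual\<close>.\<close>

lemma attainable_residual_curve:
  fixes w :: "real^'n::{finite,linorder}"
  assumes "A = tritoep a (\<tau> * \<xi>) (\<tau> / \<xi>)" "invertible A" "w \<noteq> 0"
    and "\<And>i :: 'm::{finite,linorder}.
      gram (\<lambda>l. ((*v) A ^^ Suc l) (unit_rhs A w)) (pos i + 1) \<noteq> 0"
  shows "attainable A (residual_curve a \<tau> \<xi> w :: real^'m::{finite,linorder})"
  unfolding attainable_def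
  by (rule exI[of _ "unit_rhs A w"])
     (simp only: norm_unit_rhs[OF assms(2,3)] residual_curve_nth[OF assms(1)]
        gmres_residual[OF assms(4)] simp_thms)

section \<open>Local invertibility of the residual curve\<close>

text \<open>The only delicate point is the normalization: invertibility and
  \<open>\<phi> u \<noteq> 0\<close> keep the norm in the denominator nonzero, where it is
  differentiable.\<close>

lemma C1_on_krylov_unit_rhs:
  fixes A :: "real^'n^'n"
  assumes "invertible A" "C1_on \<phi> P" "\<And>u. u \<in> P \<Longrightarrow> \<phi> u \<noteq> 0"
  shows "C1_on (\<lambda>u. ((*v) A ^^ l) (unit_rhs A (\<phi> u))) P"
proof (induction l)
  case 0
  have "C1_on (\<lambda>u. matrix_inv A *v \<phi> u) P"
    by (intro C1_on_bounded_linear[OF _ assms(2)] matrix_vector_mul_bounded_linear)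
  then show ?case
    unfolding unit_rhs_def using matrix_inv_mult_nonzero[OF assms(1)] assms(3)
    by (auto intro!: C1_on_scaleR C1_on_divide C1_on_norm C1_on_const)
next
  case (Suc l)
  then show ?case
    using C1_on_bounded_linear[OF matrix_vector_mul_bounded_linear Suc] by simp
qed

lemma C1_on_residual_curve:
  fixes \<phi> :: "'a::real_normed_vector \<Rightarrow> real^'n::{finite,linorder}"
  assumes "A = tritoep a (\<tau> * \<xi>) (\<tau> / \<xi>)" "invertible A"
    and "C1_on \<phi> P" "\<And>u. u \<in> P \<Longrightarrow> \<phi> u \<noteq> 0"
    and nz: "\<And>u i. u \<in> P \<Longrightarrow>
      gram (\<lambda>l. ((*v) A ^^ Suc l) (unit_rhs A (\<phi> u))) (pos (i :: 'm::{finite,linorder}) + 1) \<noteq> 0"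
  shows "C1_on (\<lambda>u. residual_curve a \<tau> \<xi> (\<phi> u) :: real^'m::{finite,linorder}) P"
proof -
  have "(\<lambda>u. residual_curve a \<tau> \<xi> (\<phi> u) :: real^'m::{finite,linorder}) = (\<lambda>u. \<chi> i.
      gram (\<lambda>l. ((*v) A ^^ l) (unit_rhs A (\<phi> u))) (Suc (pos i + 1)) /
      gram (\<lambda>l. ((*v) A ^^ Suc l) (unit_rhs A (\<phi> u))) (pos i + 1))"
    by (simp only: fun_eq_iff Finite_Cartesian_Product.vec_eq_iff vec_lambda_beta residual_curve_nth[OF assms(1)] simp_thms)
  then show ?thesis
    by (simp only:)
       (intro C1_on_vec_lambda C1_on_divide C1_on_gram C1_on_krylov_unit_rhs assms)
qed

text \<open>Adapts the inverse function theorem from bounded linear maps to Jacobian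
  matrices.\<close>

lemma C1_local_homeomorphism:
  fixes f :: "real^'m \<Rightarrow> real^'m"
  assumes "open S" "p \<in> S" "C1_on f S" "invertible (jacobian f (at p))"
  obtains T V g where "open T" "T \<subseteq> S" "p \<in> T" "open V" "f p \<in> V" "homeomorphism T V f g"
proof -
  obtain f' where cont: "continuous_on S f'"
      and der: "\<And>x. x \<in> S \<Longrightarrow> (f has_derivative blinfun_apply (f' x)) (at x)"
    using assms(3) unfolding C1_on_def by blast
  obtain B where B: "B ** jacobian f (at p) = mat 1"
    using assms(4) unfolding invertible_def by blast
  \<comment> \<open>Uniqueness of the derivative identifies \<open>f' p\<close> with the Jacobian,
    so multiplication by \<open>B\<close> is its left inverse.\<close>
  have "blinfun_apply (f' p) = (*v) (jacobian f (at p))"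
    unfolding jacobian_def frechet_derivative_at[OF der[OF assms(2)], symmetric]
    by (simp add: fun_eq_iff matrix_works linear_matrix_vector_mul_eq
        bounded_linear.linear[OF blinfun.bounded_linear_right])
  then have inv: "Blinfun ((*v) B) o\<^sub>L f' p = id_blinfun"
    by (intro blinfun_eqI)
       (simp add: bounded_linear_Blinfun_apply matrix_vector_mul_bounded_linear
          matrix_vector_mul_assoc B)
  show thesis
    by (rule inverse_function_theorem[OF assms(1) der cont assms(2) inv]) (assumption | rule that)+
qed

theorem theorem3p26:
  fixes a \<tau> \<xi> :: real
    and A :: "real^'n::{finite,linorder}^'n::{finite,linorder}"
    and w1 :: "real^'n::{finite,linorder}"
    and \<phi> :: "real^'m::{finite,linorder} \<Rightarrow> real^'n::{finite,linorder}"
    and P :: "(real^'m::{finite,linorder}) set"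
    and p :: "real^'m::{finite,linorder}"
  assumes "CARD('n) = CARD('m) + 1"
    and "A = tritoep a (\<tau> * \<xi>) (\<tau> / \<xi>)"
    and "\<tau> \<noteq> 0" and "\<xi> \<noteq> 0"
    and "invertible A"
    and "w1 \<in> sphere 0 1"
    and "full_grade A w1"
    and "local_coordinates \<phi> P p w1"
    and "invertible (curve_jacobian a \<tau> \<xi> \<phi> p)"
  shows "\<exists>U V.
      openin (top_of_set (sphere 0 1)) U \<and> w1 \<in> U \<and>
      open V \<and> (residual_curve a \<tau> \<xi> w1 :: real^'m::{finite,linorder}) \<in> V \<and>
      bij_betw (residual_curve a \<tau> \<xi>) U V \<and>
      (\<forall>f\<in>V. attainable A f)"
proof -
  let ?F = "residual_curve a \<tau> \<xi> :: real^'n::{finite,linorder} \<Rightarrow> real^'m::{finite,linorder}"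
  let ?D = "\<lambda>i u. gram (\<lambda>l. ((*v) A ^^ Suc l) (unit_rhs A (\<phi> u))) (pos (i :: 'm) + 1)"
  obtain \<psi> where P: "open P" "p \<in> P" "\<phi> p = w1" "C1_on \<phi> P"
      and ope: "openin (top_of_set (sphere 0 1)) (\<phi> ` P)" and hom: "homeomorphism P (\<phi> ` P) \<phi> \<psi>"
    using assms(8) unfolding local_coordinates_def C1_on_def by blast
  have nz: "\<phi> u \<noteq> 0" if "u \<in> P" for u
    using openin_imp_subset[OF ope] that by force
  \<comment> \<open>The parameters at which all denominators are nonzero: a finite intersection of
    open sets, contained in \<open>P\<close> because the index type is nonempty.\<close>
  define S where "S = (\<Inter>i. {u \<in> P. ?D i u \<noteq> 0})"
  have "open S"
    unfolding S_def
  proof (rule open_INT; (intro ballI)?)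
    fix i :: 'm
    have "continuous_on P (?D i)"
      by (intro C1_on_imp_continuous_on C1_on_gram C1_on_krylov_unit_rhs assms P nz)
    then have "open (P \<inter> ?D i -` (- {0}))"
      by (intro continuous_open_preimage P) auto
    moreover have "P \<inter> ?D i -` (- {0}) = {u \<in> P. ?D i u \<noteq> 0}"
      by auto
    ultimately show "open {u \<in> P. ?D i u \<noteq> 0}"
      by simp
  qed simp
  have "S \<subseteq> P"
    unfolding S_def by blast
  have "p \<in> S"
  proof -
    have "?D i p \<noteq> 0" for i
    proof -
      \<comment> \<open>Positions stay below \<open>n - 1\<close>, so \<open>k = pos i + 1\<close>
        is within the range covered by full grade.\<close>
      have "pos i + 1 \<le> CARD('n)"
        using pos_less_card[of i] assms(1) by simp
      then show ?thesis
        using gram_krylov_nonzero[OF assms(5,7)] nz[OF P(2)] P(3) by simp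
    qed
    then show ?thesis
      using P(2) by (simp add: S_def)
  qed
  have "C1_on (\<lambda>u. ?F (\<phi> u)) S"
    by (rule C1_on_residual_curve[OF assms(2,5) C1_on_subset[OF P(4) \<open>S \<subseteq> P\<close>]])
       (use nz in \<open>auto simp: S_def simp del: funpow.simps\<close>)
  moreover have "invertible (jacobian (\<lambda>u. ?F (\<phi> u)) (at p))"
    using assms(9) unfolding curve_jacobian_def .
  ultimately obtain T V g where T: "open T" "T \<subseteq> S" "p \<in> T" and V: "open V" "?F (\<phi> p) \<in> V"
      and homF: "homeomorphism T V (\<lambda>u. ?F (\<phi> u)) g"
    using C1_local_homeomorphism[OF \<open>open S\<close> \<open>p \<in> S\<close>] by blast
  have "T \<subseteq> P"
    using T(2) \<open>S \<subseteq> P\<close> by blast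
  have "openin (top_of_set (\<phi> ` P)) (\<phi> ` T)"
    by (rule homeomorphism_imp_open_map[OF hom]) (use T(1) \<open>T \<subseteq> P\<close> in \<open>simp add: open_subset\<close>)
  then have "openin (top_of_set (sphere 0 1)) (\<phi> ` T)"
    using ope by (rule openin_trans)
  moreover have "w1 \<in> \<phi> ` T"
    using T(3) P(3) by blast
  moreover have "bij_betw ?F (\<phi> ` T) V"
  proof (rule bij_betw_imageI)
    have "inj_on (\<lambda>u. ?F (\<phi> u)) T"
      by (rule inj_on_inverseI[where g = g]) (rule homeomorphism_apply1[OF homF])
    then show "inj_on ?F (\<phi> ` T)"
      by (auto simp: inj_on_def)
    show "?F ` \<phi> ` T = V"
      using homeomorphism_image1[OF homF] by (simp add: image_image)
  qed
  moreover have "attainable A f" if f: "f \<in> V" for f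
  proof -
    have "f \<in> (\<lambda>u. ?F (\<phi> u)) ` T"
      using f homeomorphism_image1[OF homF] by simp
    then obtain u where u: "u \<in> T" "f = ?F (\<phi> u)"
      by (rule imageE)
    \<comment> \<open>Full grade is assumed only at \<open>w1\<close>; at the other points
      membership in \<open>S\<close> provides the nonzero denominators.\<close>
    then have "\<phi> u \<noteq> 0" "\<And>i. ?D i u \<noteq> 0"
      using nz \<open>T \<subseteq> P\<close> T(2) unfolding S_def by blast+
    then show ?thesis
      unfolding u(2) by (rule attainable_residual_curve[OF assms(2,5)])
  qed
  ultimately show ?thesis
    using V P(3) by (intro exI[of _ "\<phi> ` T"] exI[of _ V]) simp
qed

end
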